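(* Let $\mu_1<0$ be a real constant, let $n\ge 2$ be an integer, and suppose $h\in C^2((0,\infty))\cap C^1([0,\infty))$ satisfies $$2r^2h(r)h_{rr}(r)=(n-1)h(r)(h(r)-1)+rh_r(r)\big(rh_r(r)-(n-1)\big),\qquad h(r)>0,\qquad \forall r>0,$$ together with $h(0)=1$ and $h_r(0)=\mu_1$. Then $$\lim_{r\to\infty}\frac{rh_r(r)}{h(r)}=-1.$$
   Context: Functions are real-valued; $h_r$ and $h_{rr}$ denote the first and second derivatives of $h$ in $r$. $C^1([0,\infty))$ means continuously differentiable up to $r=0$, with $h_r(0)$ the one-sided derivative at $0$. *)

theory Defs
  imports "HOL-Analysis.Analysis"
begin

end

theory Submission
  imports Defs "HOL-Real_Asymp.Real_Asymp"
begin

text \<open>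
  In the variable \<open>t = ln r\<close> put \<open>X = r h\<^sub>r / h\<close>, \<open>Y = 1 / h\<close> and \<open>m = n - 1\<close>. The equation becomes the
  autonomous system \<open>X' = X - X\<^sup>2/2 + m/2 - (m Y/2) (1 + X)\<close>, \<open>Y' = - X Y\<close>. Close to \<open>r = 0\<close> we have
  \<open>X < 0\<close> and \<open>Y > 1\<close>; a barrier argument keeps \<open>X \<le> -\<eta> < 0\<close>, so \<open>Y\<close> tends to infinity, and then
  the term \<open>- (m Y/2) (1 + X)\<close> drives \<open>X\<close> to \<open>-1\<close>. The competing term \<open>- X\<^sup>2/2\<close> is harmless because
  \<open>X / sqrt Y\<close> (twice the \<open>t\<close>-derivative of \<open>sqrt h\<close>) increases wherever \<open>X \<le> -2\<close> and \<open>Y\<close> is large,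
  whence \<open>X\<^sup>2 = O(\<bar>X\<bar> sqrt Y)\<close>.
\<close>

section \<open>Barrier arguments for scalar differential inequalities\<close>

text \<open>At the infimum \<open>s\<close> of the times where \<open>f\<close> exceeds
  \<open>c\<close>, continuity forces \<open>f s = c\<close>; a negative derivative there keeps
  \<open>f\<close> below \<open>c\<close> just after \<open>s\<close>, contradicting the infimum.
  The sign of \<open>f' s\<close> may be proved from the bound on all of \<open>[a, s]\<close>, so
  that facts depending on the past can be bootstrapped.\<close>

lemma barrier_le:
  fixes f f' :: "real \<Rightarrow> real"
  assumes deriv: "\<And>t. t \<ge> a \<Longrightarrow> (f has_real_derivative f' t) (at t)"
    and start: "f a \<le> c"
    and inward: "\<And>s. s \<ge> a \<Longrightarrow> f s = c \<Longrightarrow> (\<And>u. a \<le> u \<Longrightarrow> u \<le> s \<Longrightarrow> f u \<le> c) \<Longrightarrow> f' s < 0"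
    and "t \<ge> a"
  shows "f t \<le> c"
proof (rule ccontr)
  assume "\<not> f t \<le> c"
  define S where "S = {u. a \<le> u \<and> f u > c}"
  define s where "s = Inf S"
  have ne: "S \<noteq> {}" and bdd: "bdd_below S"
    using \<open>\<not> f t \<le> c\<close> \<open>t \<ge> a\<close> by (auto simp: S_def)
  have "s \<ge> a"
    unfolding s_def by (rule cInf_greatest[OF ne]) (auto simp: S_def)
  have before: "f u \<le> c" if "a \<le> u" "u < s" for u
    using cInf_lower[OF _ bdd, of u] that by (force simp: S_def s_def)
  have cont: "isCont f s"
    using deriv[OF \<open>s \<ge> a\<close>] by (rule DERIV_isCont)
  have fs: "f s \<le> c"
  proof (rule ccontr)
    assume "\<not> f s \<le> c"
    then have "s > a" using start \<open>s \<ge> a\<close> by (cases "s = a") auto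
    have "eventually (\<lambda>u. f u > c) (at_left s)"
    proof (rule order_tendstoD)
      show "(f \<longlongrightarrow> f s) (at_left s)"
        using cont by (simp add: isCont_def filterlim_at_split)
    qed (use \<open>\<not> f s \<le> c\<close> in simp)
    moreover have "eventually (\<lambda>u. a < u \<and> u < s) (at_left s)"
      using \<open>s > a\<close> by (auto simp: eventually_at_left_field)
    ultimately have "eventually (\<lambda>u. False) (at_left s)"
    proof eventually_elim
      case (elim u)
      then show ?case using before[of u] by simp
    qed
    then show False by simp
  qed
  have near: "\<exists>u. s \<le> u \<and> u < s + e \<and> f u > c" if pos: "e > 0" for e
  proof -
    obtain u where "u \<in> S" "u < s + e"
      using cInf_lessD[OF ne, of "s + e"] pos by (auto simp: s_def)
    then show ?thesis
      using cInf_lower[OF _ bdd, of u] by (auto simp: S_def s_def)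
  qed
  have "f s = c"
  proof (rule ccontr)
    assume "f s \<noteq> c"
    then have "eventually (\<lambda>u. f u < c) (nhds s)"
      using fs cont unfolding isCont_def tendsto_at_iff_tendsto_nhds
      by (intro order_tendstoD(2)) auto
    then obtain e where e: "e > 0" "\<And>u. dist u s < e \<Longrightarrow> f u < c"
      by (auto simp: eventually_nhds_metric)
    obtain u where "s \<le> u" "u < s + e" "f u > c"
      using near[OF e(1)] by auto
    then show False using e(2)[of u] by (simp add: dist_real_def)
  qed
  then have "f' s < 0"
    using inward[of s] \<open>s \<ge> a\<close> before fs by (metis order.order_iff_strict)
  then obtain d where d: "d > 0" "\<And>h. 0 < h \<Longrightarrow> h < d \<Longrightarrow> f (s + h) < f s"
    using DERIV_neg_dec_right[OF deriv[OF \<open>s \<ge> a\<close>]] by auto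
  obtain u where u: "s \<le> u" "u < s + d" "f u > c"
    using near[OF \<open>d > 0\<close>] by auto
  then have "u \<noteq> s" using \<open>f s = c\<close> by auto
  then show False
    using d(2)[of "u - s"] u \<open>f s = c\<close> by simp
qed

text \<open>Above \<open>c\<close> the function falls at least at unit speed, so it reaches
  \<open>c\<close> in finite time; afterwards the barrier at \<open>c\<close> prevents a
  return.\<close>

lemma eventually_le_of_deriv_le:
  fixes f f' :: "real \<Rightarrow> real"
  assumes "eventually (\<lambda>t. (f has_real_derivative f' t) (at t) \<and> (f t \<ge> c \<longrightarrow> f' t \<le> -1)) at_top"
  shows "eventually (\<lambda>t. f t \<le> c) at_top"
proof -
  obtain T where T: "\<And>t. t \<ge> T \<Longrightarrow> (f has_real_derivative f' t) (at t)"
      "\<And>t. t \<ge> T \<Longrightarrow> f t \<ge> c \<Longrightarrow> f' t \<le> -1"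
    using assms by (auto simp: eventually_at_top_linorder)
  have "\<exists>s\<ge>T. f s \<le> c"
  proof (rule ccontr)
    assume "\<not> ?thesis"
    then have above: "f t > c" if "t \<ge> T" for t
      using that by force
    \<comment> \<open>The time at which unit-speed descent from \<open>f T\<close> has covered the
      whole height above \<open>c\<close>.\<close>
    define b where "b = T + (f T - c)"
    have "f b + b \<le> f T + T"
    proof (rule DERIV_nonpos_imp_nonincreasing[of T b "\<lambda>t. f t + t"])
      show "T \<le> b" using above[of T] by (simp add: b_def)
      show "\<exists>y. ((\<lambda>t. f t + t) has_real_derivative y) (at t) \<and> y \<le> 0" if "T \<le> t" "t \<le> b" for t
        using T[of t] above[of t] that by (intro exI[of _ "f' t + 1"]) (auto intro!: derivative_intros)
    qed
    moreover have "f b > c" using above[of T] by (intro above) (simp add: b_def)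
    ultimately show False by (simp add: b_def)
  qed
  then obtain s where s: "s \<ge> T" "f s \<le> c" by auto
  have "f t \<le> c" if "t \<ge> s" for t
  proof (rule barrier_le[of s f f' c t])
    show "f' u < 0" if "u \<ge> s" "f u = c" for u
      using T(2)[of u] that s by auto
  qed (use T s that in auto)
  then show ?thesis by (auto simp: eventually_at_top_linorder)
qed

section \<open>Asymptotics of the planar autonomous system\<close>

lemma autonomous_system_tendsto:
  fixes X Y :: "real \<Rightarrow> real" and m a :: real
  assumes m: "m \<ge> 1"
    and dX: "\<And>t. (X has_real_derivative X t - (X t)\<^sup>2 / 2 + m / 2 - m * Y t / 2 * (1 + X t)) (at t)"
    and dY: "\<And>t. (Y has_real_derivative - X t * Y t) (at t)"
    and Ypos: "\<And>t. Y t > 0"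
    and Xa: "X a < 0" and Ya: "Y a > 1"
  shows "(X \<longlongrightarrow> -1) at_top"
proof -
  \<comment> \<open>The first entry puts \<open>X a\<close> below the barrier -\<eta>; the second
    gives \<open>(1 - \<eta>) * Y a \<ge> 1\<close>, by which the \<open>Y\<close> term cancels
    \<open>m / 2\<close> on the barrier.\<close>
  define \<eta> where "\<eta> = min (- X a) (1 - 1 / Y a)"
  have \<eta>: "\<eta> > 0" "X a \<le> -\<eta>" "\<eta> < 1" "(1 - \<eta>) * Y a \<ge> 1"
  proof -
    show "\<eta> > 0" "X a \<le> -\<eta>" using Xa Ya by (auto simp: \<eta>_def)
    show "\<eta> < 1" using Ya by (auto simp: \<eta>_def min_less_iff_disj)
    have "1 - \<eta> \<ge> 1 / Y a" by (auto simp: \<eta>_def)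
    then show "(1 - \<eta>) * Y a \<ge> 1" using Ya by (simp add: field_simps)
  qed
  \<comment> \<open>The bound on \<open>X\<close> is only assumed up to \<open>s\<close>, because
    this is used inside the barrier argument that establishes it.\<close>
  have Ymono: "Y a \<le> Y s" if "s \<ge> a" and "\<And>u. a \<le> u \<Longrightarrow> u \<le> s \<Longrightarrow> X u \<le> -\<eta>" for s
  proof (rule DERIV_nonneg_imp_nondecreasing[OF that(1)])
    show "\<exists>y. (Y has_real_derivative y) (at u) \<and> y \<ge> 0" if "a \<le> u" "u \<le> s" for u
      using dY[of u] Ypos[of u] \<open>\<And>u. a \<le> u \<Longrightarrow> u \<le> s \<Longrightarrow> X u \<le> -\<eta>\<close>[OF that] \<eta>(1)
      by (intro exI[of _ "- X u * Y u"]) (auto simp: mult_le_0_iff)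
  qed
  have X\<eta>: "X t \<le> -\<eta>" if "t \<ge> a" for t
  proof (rule barrier_le[OF dX \<eta>(2) _ that])
    fix s assume s: "s \<ge> a" "X s = -\<eta>" "\<And>u. a \<le> u \<Longrightarrow> u \<le> s \<Longrightarrow> X u \<le> -\<eta>"
    have "(1 - \<eta>) * Y s \<ge> (1 - \<eta>) * Y a"
      using Ymono[OF s(1,3)] \<eta> by (intro mult_left_mono) auto
    then have "m * ((1 - \<eta>) * Y s) \<ge> m * 1"
      using \<eta>(4) m by (intro mult_left_mono) auto
    then have "m * Y s / 2 * (1 + X s) \<ge> m / 2"
      by (simp add: s(2) mult_ac)
    then show "X s - (X s)\<^sup>2 / 2 + m / 2 - m * Y s / 2 * (1 + X s) < 0"
      using \<eta>(1) zero_le_power2[of "X s"] s(2) by linarith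
  qed
  \<comment> \<open>Since \<open>Y \<ge> 1\<close> and \<open>- X \<ge> \<eta>\<close>, the
    derivative \<open>- X * Y\<close> is at least \<eta>, so \<open>Y\<close> dominates a line of
    slope \<eta>.\<close>
  have Ytop: "filterlim Y at_top at_top"
  proof (rule filterlim_at_top_mono)
    show "filterlim (\<lambda>t. Y a + \<eta> * (t - a)) at_top at_top"
      using \<eta>(1) by real_asymp
    have "Y a + \<eta> * (t - a) \<le> Y t" if "t \<ge> a" for t
    proof -
      have "Y a - \<eta> * a \<le> Y t - \<eta> * t"
      proof (rule DERIV_nonneg_imp_nondecreasing[OF that, of "\<lambda>t. Y t - \<eta> * t"])
        fix u assume u: "a \<le> u" "u \<le> t"
        have "Y u \<ge> 1" using Ymono[OF u(1)] X\<eta> Ya by force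
        then have "\<eta> * 1 \<le> - X u * Y u"
          using X\<eta>[OF u(1)] \<eta>(1) by (intro mult_mono) auto
        then show "\<exists>y. ((\<lambda>t. Y t - \<eta> * t) has_real_derivative y) (at u) \<and> y \<ge> 0"
          by (intro exI[of _ "- X u * Y u - \<eta>"]) (auto intro!: derivative_eq_intros dY)
      qed
      then show ?thesis by (simp add: algebra_simps)
    qed
    then show "eventually (\<lambda>t. Y a + \<eta> * (t - a) \<le> Y t) at_top"
      by (auto simp: eventually_at_top_linorder)
  qed
  have large: "eventually (\<lambda>t. P (Y t)) at_top" if "eventually P at_top" for P
    using Ytop that by (simp add: filterlim_iff)
  obtain b where b: "\<And>t. t \<ge> b \<Longrightarrow> Y t \<ge> 4"
    using large[OF eventually_ge_at_top[of 4]] by (auto simp: eventually_at_top_linorder)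
  \<comment> \<open>The second entry starts the quotient at or below \<open>C\<close>; the 2 forces
    \<open>- X \<ge> 2\<close> wherever the quotient equals \<open>C\<close>, as
    \<open>sqrt Y \<ge> 1\<close>.\<close>
  define C where "C = max 2 (- X b / sqrt (Y b))"
  have XC: "- X t \<le> C * sqrt (Y t)" if "t \<ge> b" for t
  proof -
    \<comment> \<open>Dividing by \<open>sqrt Y\<close> is chosen because
      \<open>Y' = - X * Y\<close> then contributes exactly what cancels the quadratic term of
      \<open>X'\<close>.\<close>
    let ?W = "\<lambda>t. - X t / sqrt (Y t)"
    have "?W t \<le> C"
    proof (rule barrier_le[of b ?W "\<lambda>s. - (X s + m / 2 - m * Y s / 2 * (1 + X s)) / sqrt (Y s)"])
      show "b \<le> t" by (rule that)
      show "?W b \<le> C" by (simp add: C_def)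
      fix s assume "s \<ge> b"
      define R where "R = sqrt (Y s)"
      have R: "R > 0" "Y s = R\<^sup>2" using Ypos[of s] by (auto simp: R_def)
      show "(?W has_real_derivative
             - (X s + m / 2 - m * Y s / 2 * (1 + X s)) / sqrt (Y s)) (at s)"
      proof -
        let ?D = "X s - (X s)\<^sup>2 / 2 + m / 2 - m * Y s / 2 * (1 + X s)"
        have "((\<lambda>t. sqrt (Y t)) has_real_derivative inverse R / 2 * (- X s * Y s)) (at s)"
          unfolding R_def by (rule DERIV_chain2[OF DERIV_real_sqrt[OF Ypos] dY])
        from DERIV_divide[OF DERIV_minus[OF dX] this] R(1)
        have "(?W has_real_derivative
            (- ?D * R - - X s * (inverse R / 2 * (- X s * Y s))) / (R * R)) (at s)"
          by (simp add: R_def del: mult_minus_left mult_minus_right)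
        moreover have "(- D * R - - x * (inverse R / 2 * (- x * R\<^sup>2))) / (R * R) = - (D + x\<^sup>2 / 2) / R"
          for D x
          using R(1) by (simp add: field_simps power2_eq_square)
        ultimately have "(?W has_real_derivative - (?D + (X s)\<^sup>2 / 2) / R) (at s)"
          by (simp only: R(2))
        then show ?thesis by (simp add: R_def diff_diff_eq algebra_simps)
      qed
      assume "?W s = C"
      then have "- X s / R = C" by (simp only: R_def)
      then have "- X s = C * R" using R(1) by (simp add: field_simps)
      moreover have "R \<ge> 1" using b[OF \<open>s \<ge> b\<close>] by (simp add: R_def)
      then have "2 * 1 \<le> C * R" by (intro mult_mono) (auto simp: C_def)
      ultimately have X2: "- X s \<ge> 2" by simp
      \<comment> \<open>With \<open>m * Y \<ge> 4\<close> the numerator is at least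
        \<open>X + m / 2 + 2 * (-1 - X) = - X - 2 + m / 2\<close>, positive for
        \<open>- X \<ge> 2\<close>.\<close>
      have "1 * 4 \<le> m * Y s"
        using m b[OF \<open>s \<ge> b\<close>] by (intro mult_mono) auto
      then have "4 * (-1 - X s) \<le> m * Y s * (-1 - X s)"
        using X2 by (intro mult_right_mono) auto
      then have "X s + m / 2 - m * Y s / 2 * (1 + X s) > 0"
        using X2 m by (simp add: algebra_simps)
      then show "- (X s + m / 2 - m * Y s / 2 * (1 + X s)) / sqrt (Y s) < 0"
        using Ypos[of s] by (simp add: divide_less_0_iff)
    qed
    then show ?thesis using Ypos[of t] by (simp add: field_simps)
  qed
  have upper: "eventually (\<lambda>t. X t \<le> -1 + \<epsilon>) at_top" if "\<epsilon> > 0" for \<epsilon>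
  proof (rule eventually_le_of_deriv_le)
    \<comment> \<open>The threshold solves \<open>m * Y * \<epsilon> \<ge> m + 2\<close>, so that
      for \<open>1 + X \<ge> \<epsilon>\<close> the damping term outweighs \<open>m / 2\<close> by
      at least 1; the other terms are not positive.\<close>
    have "eventually (\<lambda>t. Y t \<ge> (1 + 2 / m) / \<epsilon>) at_top"
      by (intro large eventually_ge_at_top)
    then show "eventually (\<lambda>t. (X has_real_derivative X t - (X t)\<^sup>2 / 2 + m / 2 - m * Y t / 2 * (1 + X t)) (at t)
        \<and> (X t \<ge> -1 + \<epsilon> \<longrightarrow> X t - (X t)\<^sup>2 / 2 + m / 2 - m * Y t / 2 * (1 + X t) \<le> -1)) at_top"
      using eventually_ge_at_top[of a]
    proof eventually_elim
      case (elim t)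
      have "X t - (X t)\<^sup>2 / 2 + m / 2 - m * Y t / 2 * (1 + X t) \<le> -1" if "X t \<ge> -1 + \<epsilon>"
      proof -
        have "m + 2 \<le> m * Y t * \<epsilon>"
          using elim(1) m \<open>\<epsilon> > 0\<close> by (simp add: field_simps)
        also have "\<dots> \<le> m * Y t * (1 + X t)"
          using that m Ypos[of t] by (intro mult_left_mono) auto
        finally have "m * Y t / 2 * (1 + X t) \<ge> m / 2 + 1" by simp
        then show ?thesis
          using X\<eta>[OF elim(2)] \<eta>(1) zero_le_power2[of "X t"] by linarith
      qed
      then show ?case using dX by blast
    qed
  qed
  have lower: "eventually (\<lambda>t. - X t \<le> 1 + \<epsilon>) at_top" if "\<epsilon> > 0" for \<epsilon>
  proof (rule eventually_le_of_deriv_le)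
    \<comment> \<open>For \<open>z = - X - 1 \<ge> \<epsilon>\<close> this gives
      \<open>- X = 1 + z \<le> z * D\<close>. Every growing term then carries a factor
      \<open>z\<close>, and the derivative of \<open>- X\<close> is at most
      \<open>- z * (Y / 2 - D * C * sqrt Y / 2 - D)\<close>.\<close>
    define D where "D = 1 + 1 / \<epsilon>"
    have "eventually (\<lambda>y. y / 2 - D * C * sqrt y / 2 - D \<ge> 1 / \<epsilon>) at_top"
      by real_asymp
    from large[OF this] show "eventually (\<lambda>t. ((\<lambda>t. - X t) has_real_derivative
           - (X t - (X t)\<^sup>2 / 2 + m / 2 - m * Y t / 2 * (1 + X t))) (at t)
        \<and> (- X t \<ge> 1 + \<epsilon> \<longrightarrow> - (X t - (X t)\<^sup>2 / 2 + m / 2 - m * Y t / 2 * (1 + X t)) \<le> -1)) at_top"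
      using eventually_ge_at_top[of b]
    proof eventually_elim
      case (elim t)
      have "- (X t - (X t)\<^sup>2 / 2 + m / 2 - m * Y t / 2 * (1 + X t)) \<le> -1" if "- X t \<ge> 1 + \<epsilon>"
      proof -
        define z where "z = - X t - 1"
        have z: "z \<ge> \<epsilon>" "X t = - 1 - z" using that by (auto simp: z_def)
        have "1 \<le> z / \<epsilon>"
          using z \<open>\<epsilon> > 0\<close> by simp
        then have XD: "- X t \<le> z * D"
          by (simp add: z(2) D_def algebra_simps)
        have "(X t)\<^sup>2 = - X t * - X t" by (simp add: power2_eq_square)
        also have "\<dots> \<le> (z * D) * (C * sqrt (Y t))"
          using XD XC[OF elim(2)] z \<open>\<epsilon> > 0\<close> by (intro mult_mono) auto
        finally have sq: "(X t)\<^sup>2 \<le> z * (D * C * sqrt (Y t))" by (simp add: algebra_simps)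
        have "1 * (Y t * z) \<le> m * (Y t * z)"
          using m Ypos[of t] z \<open>\<epsilon> > 0\<close> by (intro mult_right_mono) auto
        moreover have "\<epsilon> * (1 / \<epsilon>) \<le> z * (Y t / 2 - D * C * sqrt (Y t) / 2 - D)"
          using elim(1) z \<open>\<epsilon> > 0\<close> by (intro mult_mono) auto
        moreover have "m * Y t / 2 * (1 + X t) = - (m * (Y t * z)) / 2"
          by (simp add: z(2))
        ultimately show ?thesis
          using sq XD m \<open>\<epsilon> > 0\<close> by (simp add: algebra_simps)
      qed
      then show ?case by (auto intro!: derivative_eq_intros dX)
    qed
  qed
  show ?thesis
  proof (rule tendstoI)
    fix e :: real assume "e > 0"
    then have "e / 2 > 0" by simp
    from upper[OF this] lower[OF this] show "eventually (\<lambda>t. dist (X t) (-1) < e) at_top"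
    proof eventually_elim
      case (elim t)
      then show ?case using \<open>e > 0\<close> by (auto simp: dist_real_def abs_less_iff field_simps)
    qed
  qed
qed

section \<open>Passage to logarithmic time and the initial data\<close>

theorem theorem1p6:
  fixes \<mu>\<^sub>1 :: real and n :: nat and h h\<^sub>r h\<^sub>r\<^sub>r :: "real \<Rightarrow> real"
  assumes "\<mu>\<^sub>1 < 0"
    and "n \<ge> 2"
    and "\<And>r. r \<ge> 0 \<Longrightarrow> (h has_real_derivative h\<^sub>r r) (at r within {0..})"
    and "continuous_on {0..} h\<^sub>r"
    and "\<And>r. r > 0 \<Longrightarrow> (h\<^sub>r has_real_derivative h\<^sub>r\<^sub>r r) (at r)"
    and "continuous_on {0<..} h\<^sub>r\<^sub>r"
    and "\<And>r. r > 0 \<Longrightarrow>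
           2 * r\<^sup>2 * h r * h\<^sub>r\<^sub>r r =
             (real n - 1) * h r * (h r - 1) + r * h\<^sub>r r * (r * h\<^sub>r r - (real n - 1))"
    and "\<And>r. r > 0 \<Longrightarrow> h r > 0"
    and "h 0 = 1"
    and "h\<^sub>r 0 = \<mu>\<^sub>1"
  shows "((\<lambda>r. r * h\<^sub>r r / h r) \<longlongrightarrow> -1) at_top"
proof -
  define m where "m = real n - 1"
  define X where "X = (\<lambda>t. exp t * h\<^sub>r (exp t) / h (exp t))"
  define Y where "Y = (\<lambda>t. 1 / h (exp t))"
  have dh: "(h has_real_derivative h\<^sub>r r) (at r)" if "r > 0" for r
    using assms(3)[of r] that at_within_interior[of r "{0..}"] by (simp add: interior_real_atLeast)
  have dh_exp: "((\<lambda>t. h (exp t)) has_real_derivative h\<^sub>r (exp t) * exp t) (at t)" for t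
    by (rule DERIV_chain2[OF dh]) (auto intro!: derivative_eq_intros)
  have dhr_exp: "((\<lambda>t. h\<^sub>r (exp t)) has_real_derivative h\<^sub>r\<^sub>r (exp t) * exp t) (at t)" for t
    by (rule DERIV_chain2[OF assms(5)]) (auto intro!: derivative_eq_intros)
  have hpos: "h (exp t) > 0" for t
    by (simp add: assms(8))
  have dY: "(Y has_real_derivative - X t * Y t) (at t)" for t
    unfolding X_def Y_def using hpos[of t]
    by (auto intro!: derivative_eq_intros dh_exp simp: field_simps power2_eq_square)
  have dX: "(X has_real_derivative X t - (X t)\<^sup>2 / 2 + m / 2 - m * Y t / 2 * (1 + X t)) (at t)" for t
  proof -
    define r H P where "r = exp t" and "H = h (exp t)" and "P = h\<^sub>r (exp t)"
    have H: "H > 0" and "r > 0" using hpos[of t] by (auto simp: H_def r_def)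
    \<comment> \<open>The equation is not degenerate for \<open>r > 0\<close>, where
      \<open>r\<close> and \<open>H\<close> are positive, so it can be solved for the second
      derivative.\<close>
    have Q: "h\<^sub>r\<^sub>r r = (m * H * (H - 1) + r * P * (r * P - m)) / (2 * r\<^sup>2 * H)"
      using assms(7)[OF \<open>r > 0\<close>] H \<open>r > 0\<close>
      by (simp add: field_simps H_def P_def m_def flip: r_def)
    have "(X has_real_derivative
            ((r * P + r * (h\<^sub>r\<^sub>r r * r)) * H - r * P * (P * r)) / H\<^sup>2) (at t)"
      unfolding X_def r_def H_def P_def using hpos[of t]
      by (auto intro!: derivative_eq_intros dh_exp dhr_exp simp: power2_eq_square algebra_simps)
    also have "((r * P + r * (h\<^sub>r\<^sub>r r * r)) * H - r * P * (P * r)) / H\<^sup>2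
        = r * P / H - (r * P / H)\<^sup>2 / 2 + m / 2 - m * (1 / H) / 2 * (1 + r * P / H)"
      unfolding Q using H \<open>r > 0\<close> by (simp add: field_simps power2_eq_square)
    finally show ?thesis by (simp add: X_def Y_def r_def H_def P_def)
  qed
  \<comment> \<open>One-sided continuity at 0 carries the negative initial slope to a right
    neighbourhood, which supplies the starting time \<open>ln r\<close> of the system.\<close>
  obtain d where d: "d > 0" "\<And>r. 0 \<le> r \<Longrightarrow> r < d \<Longrightarrow> h\<^sub>r r < 0"
  proof -
    have "(h\<^sub>r \<longlongrightarrow> \<mu>\<^sub>1) (at 0 within {0..})"
      using assms(4,10) by (force simp: continuous_on_def)
    then have "eventually (\<lambda>r. h\<^sub>r r < 0) (at 0 within {0..})"
      using assms(1) by (rule order_tendstoD)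
    then obtain d where "d > 0" "\<And>r. r \<ge> 0 \<Longrightarrow> r \<noteq> 0 \<Longrightarrow> dist r 0 < d \<Longrightarrow> h\<^sub>r r < 0"
      unfolding eventually_at by auto
    then show ?thesis
      using that[of d] assms(1,10) by (metis abs_of_nonneg diff_zero dist_real_def)
  qed
  define r where "r = d / 2"
  have r: "0 < r" "r < d" using d(1) by (auto simp: r_def)
  \<comment> \<open>By the mean value theorem \<open>h\<close> has dropped below 1 at
    \<open>r\<close>, which is the condition \<open>Y > 1\<close> at time
    \<open>ln r\<close>.\<close>
  have "h r < h 0"
  proof -
    have "continuous_on {0..r} h"
      by (rule DERIV_continuous_on, rule DERIV_subset[OF assms(3)]) auto
    then obtain l z where z: "0 < z" "z < r" "(h has_real_derivative l) (at z)" "h r - h 0 = (r - 0) * l"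
      using MVT[OF r(1), of h] dh real_differentiable_def by (metis)
    then have "l = h\<^sub>r z" using DERIV_unique dh by blast
    then show ?thesis using z d(2)[of z] r mult_pos_neg[of r "h\<^sub>r z"] by simp
  qed
  then have "X (ln r) < 0" "Y (ln r) > 1"
    using r d(2)[of r] assms(8)[of r] assms(9)
    by (auto simp: X_def Y_def divide_less_0_iff mult_less_0_iff)
  moreover have "m \<ge> 1" using assms(2) by (simp add: m_def)
  ultimately have "(X \<longlongrightarrow> -1) at_top"
    using dX dY hpos by (intro autonomous_system_tendsto[of m X Y]) (auto simp: Y_def)
  then have "((\<lambda>r. X (ln r)) \<longlongrightarrow> -1) at_top"
    by (rule filterlim_compose[OF _ ln_at_top])
  moreover have "eventually (\<lambda>r. X (ln r) = r * h\<^sub>r r / h r) at_top"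
    using eventually_gt_at_top[of 0] by eventually_elim (simp add: X_def)
  ultimately show ?thesis
    by (simp add: filterlim_cong)
qed

end
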